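(* Let $X$ be a uniformly convex and uniformly smooth Banach space with dual $X^*$, and let $K$ be a cone in $X$ with vertex at $v$. Let $K_\pi^{\perp}=\{\psi\in X^*:\ \langle\psi-Jv,v-z\rangle\ge 0\ \text{for all } z\in K\}$ be the generalized dual cone of $K$ in $X^*$ with respect to the generalized projection $\pi$. Then the following statements hold: (a) $K_\pi^{\perp}=\pi_K^{-1}(v)$, where $\pi_K^{-1}(v)=\{\psi\in X^*:\pi_K(\psi)=v\}$. (b) $K_\pi^{\perp}$ is a closed and convex cone with vertex at $Jv$ in $X^*$. (c) $K$ and $K_\pi^{\perp}$ are generalized duals of each other: $K=(K_\pi^{\perp})_\pi^{\perp}$.
   Context: Banach spaces are real; $\langle\cdot,\cdot\rangle$ is the duality pairing between $X^*$ and $X$. The normalized duality mapping $J:X\to X^*$ is the single-valued bijection determined by $\langle Jx,x\rangle=\|Jx\|_{X^*}^2=\|x\|_X^2$; its inverse $J^*:X^*\to X$ is the normalized duality mapping of $X^*$ (with $X^{**}$ identified with $X$). A cone with vertex $v$ is a set $K$ containing $v$ such that $v+t(x-v)\in K$ for all $x\in K$, $t\ge0$. Let $V(\psi,y)=\|\psi\|_{X^*}^2-2\langle\psi,y\rangle+\|y\|_X^2$ for $\psi\in X^*$, $y\in X$. For a nonempty, closed and convex set $C\subseteq X$, the generalized projection $\pi_C:X^*\to C$ is the single-valued map satisfying $V(\psi,\pi_C\psi)=\inf_{y\in C}V(\psi,y)$ for all $\psi\in X^*$; for the cone $K$, $\pi_K(\psi)=v$ means, by the same formula, $V(\psi,v)=\inf_{y\in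 K}V(\psi,y)$. Applying the definition of the generalized dual cone in $X^*$ (whose dual is $X$) to the cone $K_\pi^{\perp}$ with vertex $Jv$, and using $J^*(Jv)=v$, one has $(K_\pi^{\perp})_\pi^{\perp}=\{x\in X:\langle Jv-\psi,\,x-v\rangle\ge 0\ \text{for all }\psi\in K_\pi^{\perp}\}$.
   Formalization: Part (c) is proved under the added assumption that K is closed and convex, which is necessary: the second dual is always closed and convex, so (c) fails e.g. for the union of the two nonnegative half-axes in the plane with v = 0. *)

theory Defs
  imports "HOL-Analysis.Analysis"
begin

text \<open>The dual of a real normed space \<open>'a\<close> is the type \<open>'a \<Rightarrow>\<^sub>L real\<close>, normed by the operator norm;
  the pairing of \<open>\<psi>\<close> with \<open>x\<close> is \<open>blinfun_apply \<psi> x\<close>.\<close>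

type_synonym 'a dual = "'a \<Rightarrow>\<^sub>L real"

definition uniformly_convex :: "'a::real_normed_vector itself \<Rightarrow> bool" where
  "uniformly_convex _ \<longleftrightarrow>
     (\<forall>\<epsilon>>0. \<exists>\<delta>>0. \<forall>x y :: 'a.
        norm x = 1 \<and> norm y = 1 \<and> norm (x - y) \<ge> \<epsilon> \<longrightarrow> norm ((1/2) *\<^sub>R (x + y)) \<le> 1 - \<delta>)"

text \<open>Equivalently, the modulus of smoothness \<open>\<rho>\<close> satisfies \<open>\<rho> t / t \<longrightarrow> 0\<close> as \<open>t \<longrightarrow> 0\<close>.\<close>

definition uniformly_smooth :: "'a::real_normed_vector itself \<Rightarrow> bool" where
  "uniformly_smooth _ \<longleftrightarrow>
     (\<forall>\<epsilon>>0. \<exists>\<delta>>0. \<forall>x y :: 'a.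
        norm x = 1 \<and> norm y \<le> \<delta> \<longrightarrow> norm (x + y) + norm (x - y) \<le> 2 + \<epsilon> * norm y)"

text \<open>Both duality mappings are single-valued everywhere when \<open>'a\<close> is a uniformly convex and
  uniformly smooth Banach space; they are only used there. The second one is the normalized duality
  mapping of the dual, with the bidual identified with \<open>'a\<close>.\<close>

definition duality_map :: "'a::real_normed_vector \<Rightarrow> 'a dual" where
  "duality_map x =
     (THE \<phi>. blinfun_apply \<phi> x = (norm \<phi>)\<^sup>2 \<and> (norm \<phi>)\<^sup>2 = (norm x)\<^sup>2)"

definition dual_duality_map :: "'a::real_normed_vector dual \<Rightarrow> 'a" where
  "dual_duality_map \<psi> =
     (THE x. blinfun_apply \<psi> x = (norm x)\<^sup>2 \<and> (norm x)\<^sup>2 = (norm \<psi>)\<^sup>2)"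

text \<open>The library's \<open>cone\<close> has its vertex at the origin.\<close>

definition cone_at :: "'a::real_vector \<Rightarrow> 'a set \<Rightarrow> bool" where
  "cone_at v K \<longleftrightarrow> v \<in> K \<and> (\<forall>x\<in>K. \<forall>t\<ge>0. v + t *\<^sub>R (x - v) \<in> K)"

definition lyapunov :: "'a::real_normed_vector dual \<Rightarrow> 'a \<Rightarrow> real" where
  "lyapunov \<psi> y = (norm \<psi>)\<^sup>2 - 2 * blinfun_apply \<psi> y + (norm y)\<^sup>2"

text \<open>\<open>is_gen_proj C \<psi> u\<close> says that the generalized projection of \<open>\<psi>\<close> onto \<open>C\<close> is \<open>u\<close>. It is a relation
  so that it also makes sense for sets that are not closed and convex, where a minimizer may fail
  to exist or to be unique. The values of \<open>lyapunov\<close> are nonnegative, so the infimum over a nonempty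
  set is a genuine one.\<close>

definition is_gen_proj :: "'a::real_normed_vector set \<Rightarrow> 'a dual \<Rightarrow> 'a \<Rightarrow> bool" where
  "is_gen_proj C \<psi> u \<longleftrightarrow> u \<in> C \<and> lyapunov \<psi> u = (INF y\<in>C. lyapunov \<psi> y)"

definition gen_proj_preimage :: "'a::real_normed_vector set \<Rightarrow> 'a \<Rightarrow> 'a dual set" where
  "gen_proj_preimage C u = {\<psi>. is_gen_proj C \<psi> u}"

definition gen_dual_cone :: "'a::real_normed_vector \<Rightarrow> 'a set \<Rightarrow> 'a dual set" where
  "gen_dual_cone v K =
     {\<psi>. \<forall>z\<in>K. blinfun_apply (\<psi> - duality_map v) (v - z) \<ge> 0}"

text \<open>The same construction for a cone \<open>L\<close> with vertex \<open>w\<close> in the dual space, the bidual being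
  identified with \<open>'a\<close>: the condition is \<open>\<langle>x - J\<^sup>* w, w - \<psi>\<rangle> \<ge> 0\<close> for the pairing of \<open>'a\<close> with its
  dual.\<close>

definition gen_dual_cone_dual :: "'a::real_normed_vector dual \<Rightarrow> 'a dual set \<Rightarrow> 'a set" where
  "gen_dual_cone_dual w L =
     {x. \<forall>\<psi>\<in>L. blinfun_apply (w - \<psi>) (x - dual_duality_map w) \<ge> 0}"

end

theory Submission
  imports Defs
begin

text \<open>In a uniformly smooth space the difference quotients of \<open>x \<mapsto> (norm x)\<^sup>2 / 2\<close> decrease to a
  linear functional, and this functional is \<open>J x\<close>; so \<open>J\<close> is obtained without the Hahn-Banach theorem,
  together with the fact that \<open>J x h\<close> is the largest lower bound of the quotients in direction \<open>h\<close>.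
  For (a), minimality of \<open>V(\<psi>, v)\<close> along the ray through \<open>z\<close> says exactly that \<open>\<psi> (z - v)\<close> is such
  a lower bound at \<open>v\<close>, and the subgradient inequality for \<open>J v\<close> gives the converse. For (c), uniform
  convexity yields a nearest point \<open>u\<close> of \<open>K\<close> to a point \<open>x\<close> outside \<open>K\<close>; the functional \<open>J (x - u)\<close> is
  nonpositive on \<open>K - v\<close> and positive at \<open>x - v\<close>, so \<open>J v + J (x - u)\<close> lies in the dual cone and
  excludes \<open>x\<close> from the second dual.\<close>

section \<open>Difference quotients and one-sided derivative of half the squared norm\<close>

definition sq_slope :: "'a::real_normed_vector \<Rightarrow> 'a \<Rightarrow> real \<Rightarrow> real" where
  "sq_slope x h t = ((norm (x + t *\<^sub>R h))\<^sup>2 - (norm x)\<^sup>2) / (2 * t)"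

lemma norm_sq_convex:
  fixes a b :: "'a::real_normed_vector"
  assumes "0 \<le> l" "l \<le> 1"
  shows "(norm ((1 - l) *\<^sub>R a + l *\<^sub>R b))\<^sup>2 \<le> (1 - l) * (norm a)\<^sup>2 + l * (norm b)\<^sup>2"
proof -
  have "norm ((1 - l) *\<^sub>R a + l *\<^sub>R b) \<le> (1 - l) * norm a + l * norm b"
    using norm_triangle_ineq[of "(1 - l) *\<^sub>R a" "l *\<^sub>R b"] assms by simp
  then have "(norm ((1 - l) *\<^sub>R a + l *\<^sub>R b))\<^sup>2 \<le> ((1 - l) * norm a + l * norm b)\<^sup>2"
    by (rule power_mono) simp
  also have "\<dots> = (1 - l) * (norm a)\<^sup>2 + l * (norm b)\<^sup>2 - l * (1 - l) * (norm a - norm b)\<^sup>2"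
    by (simp add: power2_eq_square algebra_simps)
  also have "\<dots> \<le> (1 - l) * (norm a)\<^sup>2 + l * (norm b)\<^sup>2"
    using assms by simp
  finally show ?thesis .
qed

text \<open>The point at parameter \<open>s\<close> is the convex combination, with weight
  \<open>s / t\<close>, of \<open>x\<close> and the point at parameter \<open>t\<close>; slopes of a
  convex function from a fixed base point therefore increase.\<close>

lemma sq_slope_mono:
  assumes "0 < s" "s \<le> t"
  shows "sq_slope x h s \<le> sq_slope x h t"
proof -
  have e: "x + s *\<^sub>R h = (1 - s / t) *\<^sub>R x + (s / t) *\<^sub>R (x + t *\<^sub>R h)"
    using assms by (simp add: algebra_simps)
  have "(norm (x + s *\<^sub>R h))\<^sup>2 \<le> (1 - s / t) * (norm x)\<^sup>2 + (s / t) * (norm (x + t *\<^sub>R h))\<^sup>2"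
    unfolding e by (rule norm_sq_convex) (use assms in auto)
  then have "(norm (x + s *\<^sub>R h))\<^sup>2 - (norm x)\<^sup>2 \<le> (s / t) * ((norm (x + t *\<^sub>R h))\<^sup>2 - (norm x)\<^sup>2)"
    by (simp add: algebra_simps)
  then show ?thesis
    using assms by (simp add: sq_slope_def field_simps)
qed

lemma sq_slope_ge:
  assumes "0 < t"
  shows "- (norm x * norm h) \<le> sq_slope x h t"
proof -
  let ?A = "norm (x + t *\<^sub>R h)"
  have "norm x - t * norm h \<le> ?A"
    using norm_diff_ineq[of x "t *\<^sub>R h"] assms by simp
  \<comment> \<open>Multiplying by \<open>norm x\<close> rather than squaring is safe even when
    \<open>norm x - t * norm h\<close> is negative; the square below then gives
    \<open>?A\<^sup>2 \<ge> 2 * norm x * ?A - (norm x)\<^sup>2\<close>.\<close>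
  then have "norm x * (norm x - t * norm h) \<le> norm x * ?A"
    by (rule mult_left_mono) simp
  moreover have "0 \<le> (?A - norm x)\<^sup>2"
    by simp
  ultimately have "- (norm x * norm h) * (2 * t) \<le> ?A\<^sup>2 - (norm x)\<^sup>2"
    by (simp add: power2_eq_square algebra_simps)
  then show ?thesis
    using assms by (simp add: sq_slope_def pos_le_divide_eq)
qed

lemma sq_slope_le:
  assumes "0 < t"
  shows "sq_slope x h t \<le> norm x * norm h + t * (norm h)\<^sup>2 / 2"
proof -
  have "norm (x + t *\<^sub>R h) \<le> norm x + t * norm h"
    using norm_triangle_ineq[of x "t *\<^sub>R h"] assms by simp
  then have "(norm (x + t *\<^sub>R h))\<^sup>2 \<le> (norm x + t * norm h)\<^sup>2"
    by (rule power_mono) simp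
  then show ?thesis
    using assms by (simp add: sq_slope_def field_simps power2_eq_square)
qed

text \<open>The parameter doubles because \<open>x + t *\<^sub>R (h + k)\<close> is the midpoint of
  the points reached from \<open>x\<close> along \<open>h\<close> and along \<open>k\<close> at
  parameter \<open>2 * t\<close>.\<close>

lemma sq_slope_add:
  assumes "0 < t"
  shows "sq_slope x (h + k) t \<le> sq_slope x h (2 * t) + sq_slope x k (2 * t)"
proof -
  have "x + t *\<^sub>R (h + k) = (1 - 1/2) *\<^sub>R (x + (2 * t) *\<^sub>R h) + (1/2) *\<^sub>R (x + (2 * t) *\<^sub>R k)"
    by (simp add: algebra_simps flip: scaleR_add_left)
  then have "(norm (x + t *\<^sub>R (h + k)))\<^sup>2
      \<le> (1 - 1/2) * (norm (x + (2 * t) *\<^sub>R h))\<^sup>2 + (1/2) * (norm (x + (2 * t) *\<^sub>R k))\<^sup>2"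
    using norm_sq_convex[of "1/2" "x + (2 * t) *\<^sub>R h" "x + (2 * t) *\<^sub>R k"] by simp
  then have "(norm (x + t *\<^sub>R (h + k)))\<^sup>2 - (norm x)\<^sup>2
      \<le> (((norm (x + (2 * t) *\<^sub>R h))\<^sup>2 - (norm x)\<^sup>2)
        + ((norm (x + (2 * t) *\<^sub>R k))\<^sup>2 - (norm x)\<^sup>2)) / 2"
    by simp
  then have "sq_slope x (h + k) t
      \<le> (((norm (x + (2 * t) *\<^sub>R h))\<^sup>2 - (norm x)\<^sup>2)
        + ((norm (x + (2 * t) *\<^sub>R k))\<^sup>2 - (norm x)\<^sup>2)) / 2 / (2 * t)"
    unfolding sq_slope_def using assms by (intro divide_right_mono) auto
  then show ?thesis
    by (simp add: sq_slope_def flip: add_divide_distrib)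
qed

lemma sq_slope_scale:
  assumes "0 < t" "0 < r"
  shows "sq_slope x (r *\<^sub>R h) t = r * sq_slope x h (r * t)"
  using assms by (simp add: sq_slope_def field_simps)

text \<open>This is the right directional derivative of half the squared norm: by monotonicity of
  the slopes the infimum is the limit at 0, so no limits have to be handled.\<close>

definition sq_gateaux :: "'a::real_normed_vector \<Rightarrow> 'a \<Rightarrow> real" where
  "sq_gateaux x h = (INF t\<in>{0<..}. sq_slope x h t)"

lemma sq_gateaux_le:
  assumes "0 < t"
  shows "sq_gateaux x h \<le> sq_slope x h t"
  unfolding sq_gateaux_def
  by (rule cINF_lower) (use assms in \<open>auto intro!: bdd_belowI2 sq_slope_ge\<close>)

text \<open>Monotonicity allows the restriction to \<open>t \<le> 1\<close>, which later keeps the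
  test points on a segment inside a convex set.\<close>

lemma le_sq_gateaux:
  assumes "\<And>t. 0 < t \<Longrightarrow> t \<le> 1 \<Longrightarrow> c \<le> sq_slope x h t"
  shows "c \<le> sq_gateaux x h"
  unfolding sq_gateaux_def
proof (rule cINF_greatest)
  fix t :: real assume "t \<in> {0<..}"
  then have "c \<le> sq_slope x h (min t 1)" and "sq_slope x h (min t 1) \<le> sq_slope x h t"
    by (auto intro: assms sq_slope_mono)
  then show "c \<le> sq_slope x h t" by simp
qed auto

lemma sq_gateaux_add: "sq_gateaux x (h + k) \<le> sq_gateaux x h + sq_gateaux x k"
proof -
  \<comment> \<open>Two independent parameters, reduced to their minimum by monotonicity, so that
    the two infima can be taken one after the other.\<close>
  have *: "sq_gateaux x (h + k) \<le> sq_slope x h s + sq_slope x k r" if "0 < s" "0 < r" for s r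
  proof -
    have "sq_gateaux x (h + k) \<le> sq_slope x (h + k) (min s r / 2)"
      by (rule sq_gateaux_le) (use that in auto)
    also have "\<dots> \<le> sq_slope x h (min s r) + sq_slope x k (min s r)"
      using sq_slope_add[of "min s r / 2" x h k] that by simp
    also have "\<dots> \<le> sq_slope x h s + sq_slope x k r"
      by (intro add_mono sq_slope_mono) (use that in auto)
    finally show ?thesis .
  qed
  have "sq_gateaux x (h + k) - sq_slope x k r \<le> sq_gateaux x h" if "0 < r" for r
    by (rule le_sq_gateaux) (use *[OF _ that] in \<open>simp add: algebra_simps\<close>)
  then have "sq_gateaux x (h + k) - sq_gateaux x h \<le> sq_gateaux x k"
    by (intro le_sq_gateaux) (simp add: algebra_simps)
  then show ?thesis by simp
qed

lemma sq_gateaux_scale: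
  assumes "0 < r"
  shows "sq_gateaux x (r *\<^sub>R h) = r * sq_gateaux x h"
proof (rule antisym)
  have "sq_gateaux x (r *\<^sub>R h) / r \<le> sq_gateaux x h"
  proof (rule le_sq_gateaux)
    fix t :: real assume "0 < t"
    then show "sq_gateaux x (r *\<^sub>R h) / r \<le> sq_slope x h t"
      using sq_gateaux_le[of "t / r" x "r *\<^sub>R h"] assms
      by (simp add: sq_slope_scale field_simps)
  qed
  then show "sq_gateaux x (r *\<^sub>R h) \<le> r * sq_gateaux x h"
    using assms by (simp add: field_simps)
  show "r * sq_gateaux x h \<le> sq_gateaux x (r *\<^sub>R h)"
    by (rule le_sq_gateaux) (use assms in \<open>simp add: sq_slope_scale sq_gateaux_le\<close>)
qed

lemma sq_gateaux_le_norm: "sq_gateaux x h \<le> norm x * norm h"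
proof (rule field_le_epsilon)
  fix e :: real assume "0 < e"
  define t where "t = e / ((norm h)\<^sup>2 + 1)"
  have p: "0 < (norm h)\<^sup>2 + 1"
    by (simp add: add_nonneg_pos)
  have t: "0 < t" "t * (norm h)\<^sup>2 \<le> e"
    using \<open>0 < e\<close> p by (auto simp: t_def field_simps)
  have "sq_gateaux x h \<le> norm x * norm h + t * (norm h)\<^sup>2 / 2"
    using sq_gateaux_le[OF t(1), of x h] sq_slope_le[OF t(1), of x h] by linarith
  then show "sq_gateaux x h \<le> norm x * norm h + e"
    using t(2) \<open>0 < e\<close> by linarith
qed

lemma sq_gateaux_self: "(norm x)\<^sup>2 \<le> sq_gateaux x x"
proof (rule le_sq_gateaux)
  fix t :: real assume t: "0 < t"
  have "x + t *\<^sub>R x = (1 + t) *\<^sub>R x" by (simp add: algebra_simps)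
  then have "norm (x + t *\<^sub>R x) = (1 + t) * norm x" using t by simp
  \<comment> \<open>The slope equals \<open>(1 + t / 2) * (norm x)\<^sup>2\<close>.\<close>
  then show "(norm x)\<^sup>2 \<le> sq_slope x x t"
    using t by (simp add: sq_slope_def field_simps power2_eq_square)
qed

section \<open>Uniform smoothness and linearity of the derivative\<close>

lemma uniformly_smoothD:
  fixes x :: "'a::real_normed_vector"
  assumes "uniformly_smooth TYPE('a)" "0 < e" "x \<noteq> 0"
  obtains d where "0 < d"
    and "\<And>y. norm y \<le> d \<Longrightarrow> norm (x + y) + norm (x - y) \<le> 2 * norm x + e * norm y"
proof -
  from assms(1,2) obtain d where d: "0 < d"
    "\<And>x y :: 'a. norm x = 1 \<and> norm y \<le> d \<Longrightarrow> norm (x + y) + norm (x - y) \<le> 2 + e * norm y"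
    unfolding uniformly_smooth_def by blast
  have n: "0 < norm x" using assms(3) by simp
  show ?thesis
  proof
    show "0 < d * norm x" using d(1) n by simp
    fix y :: 'a assume "norm y \<le> d * norm x"
    then have "norm (y /\<^sub>R norm x) \<le> d" using n by (simp add: field_simps)
    then have "norm (x /\<^sub>R norm x + y /\<^sub>R norm x) + norm (x /\<^sub>R norm x - y /\<^sub>R norm x)
        \<le> 2 + e * norm (y /\<^sub>R norm x)"
      using n by (intro d(2)) simp
    then have "(norm (x + y) + norm (x - y)) / norm x \<le> 2 + e * (norm y / norm x)"
      by (simp add: divide_inverse_commute distrib_left flip: scaleR_add_right scaleR_diff_right)
    then show "norm (x + y) + norm (x - y) \<le> 2 * norm x + e * norm y"
      using n by (simp add: pos_divide_le_eq distrib_right)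
  qed
qed

text \<open>Smoothness makes the second difference of the norm o(t). It passes to the squared norm
  through 2(a^2 + b^2) = (a + b)^2 + (a - b)^2, where a and b are the norms at x + th and x - th:
  the first square is controlled by smoothness, the second is O(t^2).\<close>

lemma sq_gateaux_odd:
  fixes x h :: "'a::real_normed_vector"
  assumes "uniformly_smooth TYPE('a)"
  shows "sq_gateaux x h + sq_gateaux x (- h) \<le> 0"
proof (cases "x = 0")
  case True
  then show ?thesis
    using sq_gateaux_le_norm[of x h] sq_gateaux_le_norm[of x "- h"] by simp
next
  case False
  show ?thesis
  proof (rule field_le_epsilon)
    fix e :: real assume "0 < e"
    define H where "H = norm h"
    define X where "X = norm x"
    have H: "0 \<le> H" and X: "0 < X" using False by (auto simp: H_def X_def)
    \<comment> \<open>Chosen so that the first-order error \<open>X * (e' * H)\<close> is at most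
      \<open>e / 2\<close>; the added 1 covers \<open>H = 0\<close>.\<close>
    define e' where "e' = e / (2 * (X * H + 1))"
    have XH: "0 \<le> X * H" using H X by simp
    have e': "0 < e'" using \<open>0 < e\<close> XH by (simp add: e'_def)
    have e'_le: "X * (e' * H) \<le> e / 2"
    proof -
      have "e' * (X * H) \<le> e' * (X * H + 1)" using e' by simp
      also have "\<dots> = e / 2" using XH by (simp add: e'_def field_simps)
      finally show ?thesis by (simp add: algebra_simps)
    qed
    obtain d where d: "0 < d"
      "\<And>y. norm y \<le> d \<Longrightarrow> norm (x + y) + norm (x - y) \<le> 2 * norm x + e' * norm y"
      using uniformly_smoothD[OF assms e' False] by blast
    \<comment> \<open>\<open>M\<close> is the coefficient of \<open>t\<^sup>2\<close> in the
      expansion below; \<open>t\<close> is then small enough both for smoothness to apply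
      (\<open>t * H \<le> d\<close>) and for \<open>t * M \<le> e\<close>.\<close>
    define M where "M = (e' * H)\<^sup>2 + 4 * H\<^sup>2"
    have M: "0 \<le> M" by (simp add: M_def)
    define t where "t = min (d / (H + 1)) (e / (M + 1))"
    have t: "0 < t" using d(1) H M \<open>0 < e\<close> by (simp add: t_def)
    have "t * H \<le> d"
    proof -
      have "t * H \<le> t * (H + 1)" using t by simp
      also have "\<dots> \<le> d / (H + 1) * (H + 1)"
        using H by (intro mult_right_mono) (auto simp: t_def)
      finally show ?thesis using H by simp
    qed
    have tM: "t * M \<le> e"
    proof -
      have "t * M \<le> t * (M + 1)" using t by simp
      also have "\<dots> \<le> e / (M + 1) * (M + 1)"
        using M by (intro mult_right_mono) (auto simp: t_def)
      finally show ?thesis using M by simp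
    qed
    define a where "a = norm (x + t *\<^sub>R h)"
    define b where "b = norm (x - t *\<^sub>R h)"
    have ab: "a + b \<le> 2 * X + e' * (t * H)"
      using d(2)[of "t *\<^sub>R h"] \<open>t * H \<le> d\<close> t by (simp add: a_def b_def X_def H_def)
    have "norm ((x + t *\<^sub>R h) - (x - t *\<^sub>R h)) = 2 * (t * H)"
      using t by (simp add: H_def flip: scaleR_2)
    then have "\<bar>a - b\<bar> \<le> 2 * (t * H)"
      using norm_triangle_ineq3[of "x + t *\<^sub>R h" "x - t *\<^sub>R h"] by (simp add: a_def b_def)
    then have "(a - b)\<^sup>2 \<le> (2 * (t * H))\<^sup>2"
      by (subst power2_abs[symmetric]) (rule power_mono, simp_all)
    moreover have "(a + b)\<^sup>2 \<le> (2 * X + e' * (t * H))\<^sup>2"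
      using ab by (rule power_mono) (simp add: a_def b_def)
    moreover have "2 * (a\<^sup>2 + b\<^sup>2) = (a + b)\<^sup>2 + (a - b)\<^sup>2"
      by (simp add: power2_eq_square algebra_simps)
    ultimately have "2 * (a\<^sup>2 + b\<^sup>2) \<le> (2 * X + e' * (t * H))\<^sup>2 + (2 * (t * H))\<^sup>2"
      by linarith
    also have "\<dots> = 4 * X\<^sup>2 + 4 * t * (X * (e' * H)) + t * (t * M)"
      by (simp add: M_def power2_eq_square algebra_simps)
    also have "\<dots> \<le> 4 * X\<^sup>2 + 4 * t * (e / 2) + t * e"
      using t e'_le tM by (intro add_mono mult_left_mono) auto
    \<comment> \<open>The estimate gives 3/2 times \<open>t * e\<close>, rounded up to match the
      denominator \<open>2 * t\<close> of the slopes.\<close>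
    finally have "a\<^sup>2 + b\<^sup>2 - 2 * X\<^sup>2 \<le> 2 * t * e"
      using mult_pos_pos[OF t \<open>0 < e\<close>] by (simp add: algebra_simps)
    moreover have "sq_slope x h t + sq_slope x (- h) t = (a\<^sup>2 + b\<^sup>2 - 2 * X\<^sup>2) / (2 * t)"
      by (simp add: sq_slope_def a_def b_def X_def flip: add_divide_distrib)
    ultimately have "sq_slope x h t + sq_slope x (- h) t \<le> e"
      using t by (simp add: pos_divide_le_eq mult.commute)
    then show "sq_gateaux x h + sq_gateaux x (- h) \<le> 0 + e"
      using sq_gateaux_le[OF t, of x h] sq_gateaux_le[OF t, of x "- h"] by linarith
  qed
qed

text \<open>Oddness turns a sublinear function into a linear one: subadditivity at
  \<open>- h\<close>, \<open>- k\<close> is the reverse inequality at \<open>h\<close>,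
  \<open>k\<close>, and the upper norm bound becomes two-sided.\<close>

lemma bounded_linear_sq_gateaux:
  fixes x :: "'a::real_normed_vector"
  assumes "uniformly_smooth TYPE('a)"
  shows "bounded_linear (sq_gateaux x)"
proof -
  note odd = sq_gateaux_odd[OF assms, of x]
  have zero: "sq_gateaux x 0 = 0"
    using odd[of 0] sq_gateaux_add[of x 0 0] by simp
  have neg: "sq_gateaux x (- h) = - sq_gateaux x h" for h
    using odd[of h] sq_gateaux_add[of x h "- h"] zero by simp
  show ?thesis
  proof (rule bounded_linear_intro[where K = "norm x"])
    fix h k
    show "sq_gateaux x (h + k) = sq_gateaux x h + sq_gateaux x k"
      using sq_gateaux_add[of x h k] sq_gateaux_add[of x "- h" "- k"] neg[of "h + k"] neg[of h] neg[of k]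
      by simp
  next
    fix r :: real and h
    consider "0 < r" | "r = 0" | "0 < - r" by linarith
    then show "sq_gateaux x (r *\<^sub>R h) = r *\<^sub>R sq_gateaux x h"
    proof cases
      case 3
      from sq_gateaux_scale[OF this, of x h] neg[of "r *\<^sub>R h"] show ?thesis by simp
    qed (auto simp: sq_gateaux_scale zero)
  next
    fix h
    show "norm (sq_gateaux x h) \<le> norm h * norm x"
      using sq_gateaux_le_norm[of x h] sq_gateaux_le_norm[of x "- h"] neg[of h]
      by (simp add: abs_le_iff mult.commute)
  qed
qed

section \<open>The normalized duality mapping as a derivative\<close>

lemma duality_pair_subgradient:
  assumes "blinfun_apply \<phi> x = (norm \<phi>)\<^sup>2" "(norm \<phi>)\<^sup>2 = (norm x)\<^sup>2"
  shows "(norm x)\<^sup>2 + 2 * blinfun_apply \<phi> (z - x) \<le> (norm z)\<^sup>2"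
proof -
  have "blinfun_apply \<phi> z \<le> norm \<phi> * norm z"
    using norm_blinfun[of \<phi> z] by simp
  moreover have "0 \<le> (norm \<phi> - norm z)\<^sup>2" by simp
  ultimately show ?thesis
    using assms by (simp add: blinfun.diff_right power2_eq_square algebra_simps)
qed

text \<open>The derivative solves the equations under \<open>THE\<close>. Any other solution is a
  subgradient of half the squared norm, hence lies below all slopes and below the derivative; a
  linear functional dominated by another one equals it.\<close>

lemma duality_map:
  fixes x :: "'a::real_normed_vector"
  assumes "uniformly_smooth TYPE('a)"
  shows duality_map_gateaux: "blinfun_apply (duality_map x) = sq_gateaux x"
    and duality_map_self: "blinfun_apply (duality_map x) x = (norm x)\<^sup>2"
    and norm_duality_map: "norm (duality_map x) = norm x"
proof -
  note bl = bounded_linear_sq_gateaux[OF assms, of x]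
  define G where "G = Blinfun (sq_gateaux x)"
  have G: "blinfun_apply G = sq_gateaux x"
    using bl by (simp add: G_def bounded_linear_Blinfun_apply)
  have Gx: "blinfun_apply G x = (norm x)\<^sup>2"
    using sq_gateaux_self[of x] sq_gateaux_le_norm[of x x] by (simp add: G power2_eq_square)
  have "norm G \<le> norm x"
  proof (rule norm_blinfun_bound)
    fix h show "norm (blinfun_apply G h) \<le> norm x * norm h"
      using sq_gateaux_le_norm[of x h] sq_gateaux_le_norm[of x "- h"] G
        blinfun.minus_right[of G h] by (simp add: abs_le_iff)
  qed simp
  moreover have "norm x \<le> norm G"
    using norm_blinfun[of G x] Gx by (cases "x = 0") (auto simp: power2_eq_square)
  ultimately have nG: "norm G = norm x" by simp
  have "duality_map x = G"
    unfolding duality_map_def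
  proof (rule the_equality)
    show "blinfun_apply G x = (norm G)\<^sup>2 \<and> (norm G)\<^sup>2 = (norm x)\<^sup>2"
      by (simp add: Gx nG)
    fix \<phi> assume \<phi>: "blinfun_apply \<phi> x = (norm \<phi>)\<^sup>2 \<and> (norm \<phi>)\<^sup>2 = (norm x)\<^sup>2"
    have le: "blinfun_apply \<phi> h \<le> blinfun_apply G h" for h
      unfolding G
    proof (rule le_sq_gateaux)
      fix t :: real assume "0 < t"
      then show "blinfun_apply \<phi> h \<le> sq_slope x h t"
        using duality_pair_subgradient[of \<phi> x "x + t *\<^sub>R h"] \<phi>
        by (simp add: sq_slope_def blinfun.scaleR_right field_simps)
    qed
    show "\<phi> = G"
    proof (rule blinfun_eqI)
      fix h show "blinfun_apply \<phi> h = blinfun_apply G h"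
        using le[of h] le[of "- h"] by (simp add: blinfun.minus_right)
    qed
  qed
  with G Gx nG show "blinfun_apply (duality_map x) = sq_gateaux x"
    and "blinfun_apply (duality_map x) x = (norm x)\<^sup>2" and "norm (duality_map x) = norm x"
    by auto
qed

text \<open>Minimality conditions enter through this form: an inequality along a short segment
  becomes a bound on the value of \<open>J x\<close>.\<close>

lemma le_duality_map:
  fixes x :: "'a::real_normed_vector"
  assumes "uniformly_smooth TYPE('a)"
    and "\<And>t. 0 < t \<Longrightarrow> t \<le> 1 \<Longrightarrow> (norm x)\<^sup>2 + 2 * t * c \<le> (norm (x + t *\<^sub>R h))\<^sup>2"
  shows "c \<le> blinfun_apply (duality_map x) h"
  unfolding duality_map_gateaux[OF assms(1)]
  by (rule le_sq_gateaux) (use assms(2) in \<open>simp add: sq_slope_def field_simps\<close>)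

section \<open>Uniform convexity: inversion of the duality mapping and nearest points\<close>

lemma uniformly_convexD:
  assumes "uniformly_convex TYPE('a::real_normed_vector)" "0 < e"
  obtains d where "0 < d"
    and "\<And>x y :: 'a. norm x = 1 \<Longrightarrow> norm y = 1 \<Longrightarrow> 2 * (1 - d) < norm (x + y) \<Longrightarrow> norm (x - y) < e"
proof -
  from assms obtain d where d: "0 < d" "\<And>x y :: 'a. norm x = 1 \<and> norm y = 1 \<and> norm (x - y) \<ge> e
      \<Longrightarrow> norm ((1/2) *\<^sub>R (x + y)) \<le> 1 - d"
    unfolding uniformly_convex_def by blast
  show ?thesis
  proof
    fix x y :: 'a
    assume "norm x = 1" "norm y = 1" "2 * (1 - d) < norm (x + y)"
    then show "norm (x - y) < e"
      using d(2)[of x y] by (cases "e \<le> norm (x - y)") auto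
  qed (rule d(1))
qed

text \<open>After normalization the sum has norm at least 2, which exceeds
  \<open>2 * (1 - d)\<close> for every \<open>d > 0\<close>, so the distance is below every
  \<open>e\<close>.\<close>

lemma uniformly_convex_strict:
  fixes x y :: "'a::real_normed_vector"
  assumes "uniformly_convex TYPE('a)" "norm x = norm y" "2 * norm x \<le> norm (x + y)"
  shows "x = y"
proof (cases "x = 0")
  case False
  then have n: "0 < norm x" by simp
  have "norm (x /\<^sub>R norm x - y /\<^sub>R norm x) < e" if e: "0 < e" for e
  proof -
    obtain d where d: "0 < d"
      "\<And>x y :: 'a. norm x = 1 \<Longrightarrow> norm y = 1 \<Longrightarrow> 2 * (1 - d) < norm (x + y) \<Longrightarrow> norm (x - y) < e"
      using uniformly_convexD[OF assms(1) e] by blast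
    have "2 \<le> norm (x /\<^sub>R norm x + y /\<^sub>R norm x)"
      using assms(3) n by (simp add: pos_le_divide_eq flip: scaleR_add_right divide_inverse_commute)
    then show ?thesis
      using n assms(2) d(1) by (intro d(2)) auto
  qed
  then have "norm (x /\<^sub>R norm x - y /\<^sub>R norm x) \<le> 0"
    by (meson less_irrefl not_le)
  then show ?thesis using n by simp
qed (use assms in simp)

text \<open>If \<open>x\<close> also solves the equations, \<open>J v\<close> attains its norm at
  both \<open>x\<close> and \<open>v\<close>, which have equal norms. Evaluating it at
  \<open>x + v\<close> gives equality in the triangle inequality, and strict convexity
  applies.\<close>

lemma dual_duality_map_duality_map:
  fixes v :: "'a::real_normed_vector"
  assumes "uniformly_convex TYPE('a)" "uniformly_smooth TYPE('a)"
  shows "dual_duality_map (duality_map v) = v"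
  unfolding dual_duality_map_def
proof (rule the_equality)
  let ?J = "duality_map v"
  note J = duality_map_self[OF assms(2), of v] norm_duality_map[OF assms(2), of v]
  show "blinfun_apply ?J v = (norm v)\<^sup>2 \<and> (norm v)\<^sup>2 = (norm ?J)\<^sup>2"
    using J by simp
  fix x assume x: "blinfun_apply ?J x = (norm x)\<^sup>2 \<and> (norm x)\<^sup>2 = (norm ?J)\<^sup>2"
  then have n: "norm x = norm v" using J by simp
  have "2 * (norm v)\<^sup>2 \<le> norm v * norm (x + v)"
    using norm_blinfun[of ?J "x + v"] x J by (simp add: blinfun.add_right)
  then have "2 * norm x \<le> norm (x + v)"
    using n by (cases "v = 0") (auto simp: power2_eq_square)
  then show "x = v"
    by (rule uniformly_convex_strict[OF assms(1) n])
qed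

text \<open>Replacing each \<open>a n\<close> by its radial projection onto the sphere of radius
  \<open>d\<close> costs little, and sums of two projections still have norm nearly
  \<open>2 * d\<close>; uniform convexity then forces the directions together.\<close>

lemma uniformly_convex_Cauchy:
  fixes a :: "nat \<Rightarrow> 'a::real_normed_vector"
  assumes uc: "uniformly_convex TYPE('a)" and d: "0 < d"
    and lim: "(\<lambda>n. norm (a n)) \<longlonglongrightarrow> d"
    and mid: "\<And>m n. 2 * d \<le> norm (a m + a n)"
  shows "Cauchy a"
proof (rule metric_CauchyI)
  fix e :: real assume e: "0 < e"
  then have "0 < e / (2 * d)" using d by simp
  from uniformly_convexD[OF uc this] obtain r where r: "0 < r"
    "\<And>x y :: 'a. norm x = 1 \<Longrightarrow> norm y = 1 \<Longrightarrow> 2 * (1 - r) < norm (x + y) \<Longrightarrow> norm (x - y) < e / (2 * d)"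
    by blast
  \<comment> \<open>The bound \<open>d\<close> keeps \<open>a n\<close> nonzero,
    \<open>d * r\<close> brings the sum of directions above \<open>2 * (1 - r)\<close>, and
    \<open>e / 4\<close> leaves \<open>e / 2\<close> for the two radial errors together.\<close>
  define s where "s = Min {d, e / 4, d * r}"
  have s: "0 < s" "s \<le> d" "s \<le> e / 4" "s \<le> d * r"
    using d e r(1) by (auto simp: s_def)
  obtain N where N: "\<And>n. N \<le> n \<Longrightarrow> \<bar>norm (a n) - d\<bar> < s"
    using LIMSEQ_D[OF lim s(1)] by auto
  define u where "u n = a n /\<^sub>R norm (a n)" for n
  have u: "norm (u n) = 1" "norm (a n - d *\<^sub>R u n) < s" if "N \<le> n" for n
  proof -
    have pos: "0 < norm (a n)" using N[OF that] s(2) by linarith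
    then show "norm (u n) = 1" by (simp add: u_def)
    have "a n = norm (a n) *\<^sub>R u n" using pos by (simp add: u_def)
    then have "a n - d *\<^sub>R u n = (norm (a n) - d) *\<^sub>R u n"
      by (metis scaleR_diff_left)
    then show "norm (a n - d *\<^sub>R u n) < s"
      using N[OF that] \<open>norm (u n) = 1\<close> by simp
  qed
  have "dist (a m) (a n) < e" if mn: "N \<le> m" "N \<le> n" for m n
  proof -
    have e1: "norm ((a m + a n) - d *\<^sub>R (u m + u n)) < 2 * s"
      using norm_triangle_ineq[of "a m - d *\<^sub>R u m" "a n - d *\<^sub>R u n"] u(2)[OF mn(1)] u(2)[OF mn(2)]
      by (simp add: algebra_simps)
    have "norm (a m + a n) \<le> norm ((a m + a n) - d *\<^sub>R (u m + u n)) + norm (d *\<^sub>R (u m + u n))"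
      using norm_triangle_ineq[of "(a m + a n) - d *\<^sub>R (u m + u n)" "d *\<^sub>R (u m + u n)"]
      by (simp only: diff_add_cancel)
    then have "2 * d - 2 * s < d * norm (u m + u n)"
      using e1 mid[of m n] d by simp
    then have "d * (2 * (1 - r)) < d * norm (u m + u n)"
      using s(4) by (simp add: algebra_simps)
    then have "2 * (1 - r) < norm (u m + u n)" using d by simp
    then have "norm (u m - u n) < e / (2 * d)"
      using u(1) mn by (intro r(2)) auto
    then have e2: "norm (d *\<^sub>R (u m - u n)) < e / 2"
      using d by (simp add: pos_less_divide_eq algebra_simps del: scaleR_diff_right)
    have "norm (a m - a n) \<le> norm (a m - d *\<^sub>R u m) + norm (d *\<^sub>R (u m - u n)) + norm (a n - d *\<^sub>R u n)"
      using norm_triangle_ineq[of "a m - d *\<^sub>R u m" "d *\<^sub>R (u m - u n)"]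
        norm_triangle_ineq4[of "(a m - d *\<^sub>R u m) + d *\<^sub>R (u m - u n)" "a n - d *\<^sub>R u n"]
      by (simp add: algebra_simps)
    then show ?thesis
      using e2 u(2)[OF mn(1)] u(2)[OF mn(2)] s(3) by (simp add: dist_norm)
  qed
  then show "\<exists>M. \<forall>m\<ge>M. \<forall>n\<ge>M. dist (a m) (a n) < e" by blast
qed

text \<open>Midpoints of a minimizing sequence stay in the convex set, so their distance to
  \<open>x\<close> is at least the infimum \<open>d\<close>. This is the midpoint condition that
  makes \<open>x - y n\<close> Cauchy; closedness gives \<open>d > 0\<close> and puts the limit in
  \<open>K\<close>.\<close>

lemma uniformly_convex_nearest_point:
  fixes K :: "'a::banach set"
  assumes uc: "uniformly_convex TYPE('a)"
    and K: "closed K" "convex K" "K \<noteq> {}" and x: "x \<notin> K"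
  obtains u where "u \<in> K" "\<And>z. z \<in> K \<Longrightarrow> norm (x - u) \<le> norm (x - z)"
proof -
  define d where "d = infdist x K"
  have d: "0 < d"
    using K x infdist_pos_not_in_closed by (auto simp: d_def)
  have le: "d \<le> norm (x - z)" if "z \<in> K" for z
    using infdist_le[OF that, of x] by (simp add: d_def dist_norm)
  have "\<exists>y\<in>K. norm (x - y) < d + 1 / real (Suc n)" for n
  proof -
    have "(INF y\<in>K. dist x y) < d + 1 / real (Suc n)"
      using K(3) by (simp add: d_def infdist_notempty)
    then show ?thesis
      using K(3) by (subst (asm) cINF_less_iff) (auto simp: dist_norm intro!: bdd_belowI2[where m = 0])
  qed
  then obtain y where y: "\<And>n. y n \<in> K" "\<And>n. norm (x - y n) < d + 1 / real (Suc n)"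
    by metis
  have lim: "(\<lambda>n. norm (x - y n)) \<longlonglongrightarrow> d"
  proof (rule tendsto_sandwich[where f = "\<lambda>_. d"])
    show "\<forall>\<^sub>F n in sequentially. d \<le> norm (x - y n)"
      using le y(1) by simp
    show "\<forall>\<^sub>F n in sequentially. norm (x - y n) \<le> d + 1 / real (Suc n)"
      using y(2) by (intro always_eventually allI less_imp_le)
    show "(\<lambda>n. d + 1 / real (Suc n)) \<longlonglongrightarrow> d"
      using LIMSEQ_inverse_real_of_nat_add[of d] by (simp add: inverse_eq_divide)
  qed simp
  have "Cauchy (\<lambda>n. x - y n)"
  proof (rule uniformly_convex_Cauchy[OF uc d lim])
    fix m n
    have "(1/2) *\<^sub>R y m + (1/2) *\<^sub>R y n \<in> K"
      using K(2) y(1) by (intro convexD) auto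
    from le[OF this] have "d \<le> norm ((1/2) *\<^sub>R ((x - y m) + (x - y n)))"
      by (simp add: algebra_simps flip: scaleR_add_left)
    then show "2 * d \<le> norm ((x - y m) + (x - y n))" by simp
  qed
  then obtain l where l: "(\<lambda>n. x - y n) \<longlonglongrightarrow> l"
    by (auto simp: Cauchy_convergent_iff convergent_def)
  have ly: "y \<longlonglongrightarrow> x - l"
    using tendsto_diff[OF tendsto_const l, of x] by simp
  have "norm l = d"
    using tendsto_norm[OF l] lim by (rule LIMSEQ_unique)
  show ?thesis
  proof
    show "x - l \<in> K"
      using K(1) y(1) ly by (rule closed_sequentially)
    show "norm (x - (x - l)) \<le> norm (x - z)" if "z \<in> K" for z
      using le[OF that] \<open>norm l = d\<close> by simp
  qed
qed

section \<open>Separation of a point from a closed convex cone\<close>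

lemma cone_at_separation:
  fixes K :: "'a::banach set"
  assumes uc: "uniformly_convex TYPE('a)" and us: "uniformly_smooth TYPE('a)"
    and cone: "cone_at v K" and K: "closed K" "convex K" and x: "x \<notin> K"
  obtains f :: "'a dual" where "\<And>z. z \<in> K \<Longrightarrow> blinfun_apply f (z - v) \<le> 0"
    and "0 < blinfun_apply f (x - v)"
proof -
  have v: "v \<in> K" and ray: "\<And>z t. z \<in> K \<Longrightarrow> 0 \<le> t \<Longrightarrow> v + t *\<^sub>R (z - v) \<in> K"
    using cone by (auto simp: cone_at_def)
  obtain u where u: "u \<in> K" "\<And>z. z \<in> K \<Longrightarrow> norm (x - u) \<le> norm (x - z)"
    using uniformly_convex_nearest_point[OF uc K _ x] v by blast
  define f where "f = duality_map (x - u)"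
  have nonpos: "blinfun_apply f (z - u) \<le> 0" if z: "z \<in> K" for z
  proof -
    \<comment> \<open>Moving from \<open>u\<close> towards \<open>z\<close> inside \<open>K\<close>
      cannot decrease the distance to \<open>x\<close>, so the derivative of half the squared norm
      at \<open>x - u\<close> in direction \<open>u - z\<close> is nonnegative.\<close>
    have "0 \<le> blinfun_apply f (u - z)"
      unfolding f_def
    proof (rule le_duality_map[OF us])
      fix t :: real assume t: "0 < t" "t \<le> 1"
      have "(1 - t) *\<^sub>R u + t *\<^sub>R z \<in> K"
        using K(2) u(1) z t by (intro convexD) auto
      from u(2)[OF this] have "norm (x - u) \<le> norm (x - u + t *\<^sub>R (u - z))"
        by (simp add: algebra_simps)
      then show "(norm (x - u))\<^sup>2 + 2 * t * 0 \<le> (norm (x - u + t *\<^sub>R (u - z)))\<^sup>2"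
        by (simp add: power_mono)
    qed
    then show ?thesis by (simp add: blinfun.diff_right)
  qed
  \<comment> \<open>The test points are the vertex and the point at parameter 2 on the ray through
    \<open>u\<close>; their differences from \<open>u\<close> are \<open>v - u\<close> and
    \<open>u - v\<close>.\<close>
  have fu: "blinfun_apply f (u - v) = 0"
    using nonpos[OF v] nonpos[OF ray[OF u(1), of 2]]
    by (simp add: blinfun.diff_right blinfun.add_right blinfun.scaleR_right)
  show ?thesis
  proof
    fix z assume z: "z \<in> K"
    show "blinfun_apply f (z - v) \<le> 0"
      using nonpos[OF z] fu by (simp add: blinfun.diff_right)
  next
    have "blinfun_apply f (x - u) = (norm (x - u))\<^sup>2"
      unfolding f_def by (rule duality_map_self[OF us])
    moreover have "x \<noteq> u" using u(1) x by blast
    ultimately have "0 < blinfun_apply f (x - u)" by simp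
    then show "0 < blinfun_apply f (x - v)"
      using fu by (simp add: blinfun.diff_right)
  qed
qed

section \<open>The functional V and the preimage of the vertex\<close>

lemma lyapunov_nonneg: "0 \<le> lyapunov \<psi> y"
proof -
  have "blinfun_apply \<psi> y \<le> norm \<psi> * norm y"
    using norm_blinfun[of \<psi> y] by simp
  moreover have "0 \<le> (norm \<psi> - norm y)\<^sup>2" by simp
  ultimately show ?thesis
    by (simp add: lyapunov_def power2_eq_square algebra_simps)
qed

lemma is_gen_proj_iff:
  "is_gen_proj C \<psi> u \<longleftrightarrow> u \<in> C \<and> (\<forall>y\<in>C. lyapunov \<psi> u \<le> lyapunov \<psi> y)"
proof -
  have bdd: "bdd_below (lyapunov \<psi> ` C)"
    by (rule bdd_belowI2[where m = 0]) (rule lyapunov_nonneg)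
  show ?thesis
    unfolding is_gen_proj_def
  proof (intro conj_cong refl iffI ballI)
    show "lyapunov \<psi> u \<le> lyapunov \<psi> y" if "lyapunov \<psi> u = (INF y\<in>C. lyapunov \<psi> y)" "y \<in> C" for y
      using that cINF_lower[OF bdd] by simp
    show "lyapunov \<psi> u = (INF y\<in>C. lyapunov \<psi> y)"
      if "u \<in> C" "\<forall>y\<in>C. lyapunov \<psi> u \<le> lyapunov \<psi> y"
      using that cINF_lower[OF bdd] by (intro antisym cINF_greatest) auto
  qed
qed

lemma gen_dual_cone_eq_preimage:
  fixes K :: "'a::real_normed_vector set"
  assumes us: "uniformly_smooth TYPE('a)" and cone: "cone_at v K"
  shows "gen_dual_cone v K = gen_proj_preimage K v"
proof -
  have v: "v \<in> K" and ray: "\<And>z t. z \<in> K \<Longrightarrow> 0 \<le> t \<Longrightarrow> v + t *\<^sub>R (z - v) \<in> K"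
    using cone by (auto simp: cone_at_def)
  have "0 \<le> blinfun_apply (\<psi> - duality_map v) (v - z)"
    if min: "\<And>y. y \<in> K \<Longrightarrow> lyapunov \<psi> v \<le> lyapunov \<psi> y" and z: "z \<in> K" for \<psi> z
  proof -
    have "blinfun_apply \<psi> (z - v) \<le> blinfun_apply (duality_map v) (z - v)"
    proof (rule le_duality_map[OF us])
      \<comment> \<open>The cone property supplies the whole ray through \<open>z\<close> as
        competitors; in the comparison of V at \<open>v\<close> with V on the ray, the norm of
        \<open>\<psi>\<close> cancels.\<close>
      fix t :: real assume "0 < t"
      then show "(norm v)\<^sup>2 + 2 * t * blinfun_apply \<psi> (z - v) \<le> (norm (v + t *\<^sub>R (z - v)))\<^sup>2"
        using min[OF ray[OF z, of t]]
        by (simp add: lyapunov_def blinfun.add_right blinfun.scaleR_right)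
    qed
    then show ?thesis by (simp add: blinfun.diff_left blinfun.diff_right)
  qed
  \<comment> \<open>By the subgradient inequality for \<open>J v\<close>, V(\<psi>, z) - V(\<psi>,
    v) is at least twice the pairing of \<open>\<psi> - J v\<close> with
    \<open>v - z\<close>.\<close>
  moreover have "lyapunov \<psi> v \<le> lyapunov \<psi> z"
    if "0 \<le> blinfun_apply (\<psi> - duality_map v) (v - z)" for \<psi> z
    using that duality_pair_subgradient[of "duality_map v" v z]
      duality_map_self[OF us, of v] norm_duality_map[OF us, of v]
    by (simp add: lyapunov_def blinfun.diff_left blinfun.diff_right)
  ultimately show ?thesis
    unfolding gen_dual_cone_def gen_proj_preimage_def is_gen_proj_iff using v by blast
qed

section \<open>The dual cone as an intersection of closed half-spaces\<close>

lemma gen_dual_cone_Inter: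
  "gen_dual_cone v K = (\<Inter>z\<in>K. {\<psi>. blinfun_apply (\<psi> - duality_map v) (v - z) \<ge> 0})"
  by (auto simp: gen_dual_cone_def)

lemma closed_gen_dual_cone: "closed (gen_dual_cone v K)"
  unfolding gen_dual_cone_Inter
  by (intro closed_INT ballI closed_Collect_le continuous_intros)

lemma convex_gen_dual_cone: "convex (gen_dual_cone v K)"
  unfolding gen_dual_cone_Inter
proof (intro convex_INT)
  fix z
  show "convex {\<psi>. blinfun_apply (\<psi> - duality_map v) (v - z) \<ge> 0}"
  proof (rule convexI)
    fix \<psi> \<phi> :: "'a dual" and a b :: real
    assume ab: "0 \<le> a" "0 \<le> b" "a + b = 1"
      and *: "\<psi> \<in> {\<psi>. blinfun_apply (\<psi> - duality_map v) (v - z) \<ge> 0}"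
        "\<phi> \<in> {\<psi>. blinfun_apply (\<psi> - duality_map v) (v - z) \<ge> 0}"
    have "a *\<^sub>R \<psi> + b *\<^sub>R \<phi> - duality_map v
        = a *\<^sub>R (\<psi> - duality_map v) + b *\<^sub>R (\<phi> - duality_map v)"
      using ab(3) by (simp add: algebra_simps flip: scaleR_add_left)
    then show "a *\<^sub>R \<psi> + b *\<^sub>R \<phi> \<in> {\<psi>. blinfun_apply (\<psi> - duality_map v) (v - z) \<ge> 0}"
      using ab * by (simp add: blinfun.add_left blinfun.scaleR_left)
  qed
qed

lemma cone_at_gen_dual_cone: "cone_at (duality_map v) (gen_dual_cone v K)"
  by (auto simp: cone_at_def gen_dual_cone_def blinfun.scaleR_left)

section \<open>Biduality\<close>

lemma gen_dual_cone_dual_gen_dual_cone: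
  fixes K :: "'a::banach set"
  assumes uc: "uniformly_convex TYPE('a)" and us: "uniformly_smooth TYPE('a)"
    and cone: "cone_at v K" and K: "closed K" "convex K"
  shows "gen_dual_cone_dual (duality_map v) (gen_dual_cone v K) = K"
proof (intro subset_antisym subsetI)
  note JJ = dual_duality_map_duality_map[OF uc us, of v]
  \<comment> \<open>Changing both signs in the pairing of \<open>J v - \<psi>\<close> with
    \<open>x - v\<close> gives the condition that defines the dual cone, with \<open>x\<close> in
    the role of \<open>z\<close>.\<close>
  show "x \<in> gen_dual_cone_dual (duality_map v) (gen_dual_cone v K)" if "x \<in> K" for x
    using that
    by (fastforce simp: gen_dual_cone_dual_def gen_dual_cone_def JJ blinfun.diff_left blinfun.diff_right)
  fix x assume x: "x \<in> gen_dual_cone_dual (duality_map v) (gen_dual_cone v K)"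
  show "x \<in> K"
  proof (rule ccontr)
    assume "x \<notin> K"
    from cone_at_separation[OF uc us cone K this] obtain f :: "'a dual" where
      f: "\<And>z. z \<in> K \<Longrightarrow> blinfun_apply f (z - v) \<le> 0" "0 < blinfun_apply f (x - v)"
      by blast
    have "duality_map v + f \<in> gen_dual_cone v K"
      using f(1) by (simp add: gen_dual_cone_def blinfun.diff_right)
    with x have "0 \<le> blinfun_apply (duality_map v - (duality_map v + f)) (x - v)"
      unfolding gen_dual_cone_dual_def JJ by blast
    with f(2) show False by (simp add: blinfun.minus_left)
  qed
qed

text \<open>Statement (c) carries closedness and convexity of \<open>K\<close> as premises because
  the second dual is an intersection of closed half-spaces, so the equality can hold only for such
  \<open>K\<close>.\<close>

theorem theorem4p3:
  fixes K :: "'a::banach set" and v :: 'a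
  assumes "uniformly_convex TYPE('a)" and "uniformly_smooth TYPE('a)"
    and "cone_at v K"
  shows "gen_dual_cone v K = gen_proj_preimage K v
    \<and> (closed (gen_dual_cone v K) \<and> convex (gen_dual_cone v K)
        \<and> cone_at (duality_map v) (gen_dual_cone v K))
    \<and> (closed K \<and> convex K \<longrightarrow>
        K = gen_dual_cone_dual (duality_map v) (gen_dual_cone v K))"
  using gen_dual_cone_eq_preimage[OF assms(2,3)]
    gen_dual_cone_dual_gen_dual_cone[OF assms] closed_gen_dual_cone[of v K]
    convex_gen_dual_cone[of v K] cone_at_gen_dual_cone[of v K]
  by blast

end
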